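(* Let $a_1,\dots,a_n,b_1,\dots,b_n$ be positive real numbers and let $k\ge 0$. Then $$\sum_{i=1}^n a_i\log\left(\frac{a_i}{b_i}+k\right)\ \ge\ \left(\sum_{i=1}^n a_i\right)\log\left(\frac{\sum_{i=1}^n a_i}{\sum_{i=1}^n b_i}+k\right),$$ and equality holds if and only if $\frac{a_1}{b_1}=\frac{a_2}{b_2}=\dots=\frac{a_n}{b_n}$.
   Context: $\log$ is the natural logarithm. *)

theory Defs
  imports Complex_Main
begin

end

theory Submission
  imports Defs
begin

text \<open>
  The function x ln (x + k) is strictly convex on the positive reals, so it lies above its tangent
  at the mediant t = (sum of the a i) / (sum of the b i), touching it only at t. Evaluating at
  a i / b i and weighting by b i, the linear terms cancel in the sum because
  the b-weighted mean of the ratios is t.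
\<close>

text \<open>Subtracting \<open>x * ln (t + k)\<close> from \<open>x * ln (x + k)\<close> and from
  its tangent at \<open>t\<close> leaves the two sides compared here. The bound splits in two:
  \<open>ln u \<le> u - 1\<close> for \<open>u = (t + k) / (x + k)\<close>, then an algebraic
  comparison whose error is a nonnegative multiple of a square.\<close>

lemma x_ln_tangent:
  fixes x t k :: real
  assumes "x > 0" "t > 0" "k \<ge> 0"
  shows "x * (ln (x + k) - ln (t + k)) \<ge> t / (t + k) * (x - t)"
    and "x * (ln (x + k) - ln (t + k)) = t / (t + k) * (x - t) \<longleftrightarrow> x = t"
proof -
  define u where "u = (t + k) / (x + k)"
  have pos: "x + k > 0" "t + k > 0" using assms by auto
  then have u: "u > 0" and ln_u: "ln (x + k) - ln (t + k) = - ln u"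
    unfolding u_def by (simp_all add: ln_div)
  have "x * (1 - u) - t / (t + k) * (x - t) = k * (x - t)\<^sup>2 / ((x + k) * (t + k))"
    using pos unfolding u_def by (simp add: divide_simps) algebra
  also have "\<dots> \<ge> 0" using pos assms by simp
  finally have slope: "t / (t + k) * (x - t) \<le> x * (1 - u)" by simp
  have "x * (1 - u) \<le> x * (- ln u)"
    using ln_le_minus_one[OF u] assms by (intro mult_left_mono) auto
  then show "x * (ln (x + k) - ln (t + k)) \<ge> t / (t + k) * (x - t)"
    using slope ln_u by simp
  show "x * (ln (x + k) - ln (t + k)) = t / (t + k) * (x - t) \<longleftrightarrow> x = t"
  proof
    assume "x * (ln (x + k) - ln (t + k)) = t / (t + k) * (x - t)"
    \<comment> \<open>The square vanishes identically when \<open>k = 0\<close>, so equality is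
      extracted from the logarithm instead: \<open>ln u = u - 1\<close> only at
      \<open>u = 1\<close>.\<close>
    then have "x * (- ln u) \<le> x * (1 - u)" using slope ln_u by simp
    then have "- ln u \<le> 1 - u" using \<open>x > 0\<close> by (simp only: mult_le_cancel_left_pos)
    then have "u = 1" using ln_le_minus_one[OF u] ln_eq_minus_one[OF u] by simp
    then show "x = t" using pos unfolding u_def by simp
  qed simp
qed

text \<open>A common ratio r gives \<open>a j = r * b j\<close> for every j; summing and dividing by
  \<open>sum b I\<close> recovers r. This brings the equality condition into the form that the
  tangent bound delivers.\<close>

lemma ratios_equal_iff_mediant:
  fixes a b :: "'i \<Rightarrow> 'a::linordered_field"
  assumes "finite I" and b_pos: "\<And>i. i \<in> I \<Longrightarrow> b i > 0"
  shows "(\<forall>i\<in>I. \<forall>j\<in>I. a i / b i = a j / b j) \<longleftrightarrow> (\<forall>i\<in>I. a i / b i = sum a I / sum b I)"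
proof
  assume eq: "\<forall>i\<in>I. \<forall>j\<in>I. a i / b i = a j / b j"
  show "\<forall>i\<in>I. a i / b i = sum a I / sum b I"
  proof
    fix i assume i: "i \<in> I"
    have "a j = a i / b i * b j" if "j \<in> I" for j
      using eq i that b_pos[OF that] by (metis nonzero_eq_divide_eq less_irrefl)
    then have "sum a I = a i / b i * sum b I" by (simp add: sum_distrib_left)
    moreover have "sum b I > 0" using assms i by (intro sum_pos) auto
    ultimately show "a i / b i = sum a I / sum b I" by simp
  qed
qed simp

theorem lemma5p2:
  fixes n :: nat and a b :: "nat \<Rightarrow> real" and k :: real
  assumes a_pos: "\<And>i. i \<in> {1..n} \<Longrightarrow> a i > 0"
    and b_pos: "\<And>i. i \<in> {1..n} \<Longrightarrow> b i > 0"
    and k_nonneg: "k \<ge> 0"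
  shows "(\<Sum>i=1..n. a i * ln (a i / b i + k))
           \<ge> (\<Sum>i=1..n. a i) * ln ((\<Sum>i=1..n. a i) / (\<Sum>i=1..n. b i) + k)
       \<and> ((\<Sum>i=1..n. a i * ln (a i / b i + k))
           = (\<Sum>i=1..n. a i) * ln ((\<Sum>i=1..n. a i) / (\<Sum>i=1..n. b i) + k)
          \<longleftrightarrow> (\<forall>i\<in>{1..n}. \<forall>j\<in>{1..n}. a i / b i = a j / b j))"
proof (cases "n = 0")
  \<comment> \<open>Both sides are 0 and the ratio condition is vacuous; the other case needs a
    nonempty index set for \<open>A\<close> and \<open>B\<close> to be positive.\<close>
  case True
  then show ?thesis by simp
next
  case False
  define A where "A = (\<Sum>i=1..n. a i)"
  define B where "B = (\<Sum>i=1..n. b i)"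
  define t where "t = A / B"
  define c where "c = t / (t + k)"
  \<comment> \<open>The excess over the tangent at \<open>t\<close>, weighted by \<open>b i\<close>;
    the total of these is the difference of the two sides of the theorem.\<close>
  define gap where
    "gap i = b i * (a i / b i * (ln (a i / b i + k) - ln (t + k)) - c * (a i / b i - t))" for i
  have "A > 0" "B > 0"
    unfolding A_def B_def using False a_pos b_pos by (auto intro!: sum_pos)
  then have "t > 0" and tB: "t * B = A" unfolding t_def by auto
  have gap_nonneg: "gap i \<ge> 0" and gap_zero: "gap i = 0 \<longleftrightarrow> a i / b i = t"
    if i: "i \<in> {1..n}" for i
  proof -
    have "a i / b i > 0" using a_pos[OF i] b_pos[OF i] by simp
    note tangent = x_ln_tangent[OF this \<open>t > 0\<close> k_nonneg, folded c_def]
    show "gap i \<ge> 0"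
      unfolding gap_def using tangent(1) b_pos[OF i] by (intro mult_nonneg_nonneg) auto
    show "gap i = 0 \<longleftrightarrow> a i / b i = t"
      unfolding gap_def using tangent(2) b_pos[OF i] by simp
  qed
  have "gap i = a i * ln (a i / b i + k) - a i * ln (t + k) - c * (a i - t * b i)"
    if "i \<in> {1..n}" for i
    using b_pos[OF that] unfolding gap_def by (simp add: algebra_simps)
  then have "sum gap {1..n} =
      (\<Sum>i=1..n. a i * ln (a i / b i + k) - a i * ln (t + k) - c * (a i - t * b i))"
    by (intro sum.cong) auto
  also have "\<dots> = (\<Sum>i=1..n. a i * ln (a i / b i + k)) - A * ln (t + k) - c * (A - t * B)"
    unfolding A_def B_def
    by (simp add: sum_subtractf flip: sum_distrib_left sum_distrib_right)
  \<comment> \<open>The choice of \<open>t\<close> as the mediant makes \<open>A - t * B\<close>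
    zero, which removes the linear term.\<close>
  finally have sum_gap:
    "sum gap {1..n} = (\<Sum>i=1..n. a i * ln (a i / b i + k)) - A * ln (t + k)"
    using tB by simp
  have "sum gap {1..n} \<ge> 0" using gap_nonneg by (intro sum_nonneg) auto
  moreover have "sum gap {1..n} = 0 \<longleftrightarrow> (\<forall>i\<in>{1..n}. gap i = 0)"
    using gap_nonneg by (intro sum_nonneg_eq_0_iff) auto
  moreover have "(\<forall>i\<in>{1..n}. \<forall>j\<in>{1..n}. a i / b i = a j / b j) \<longleftrightarrow> (\<forall>i\<in>{1..n}. a i / b i = t)"
    unfolding t_def A_def B_def using b_pos by (intro ratios_equal_iff_mediant) auto
  ultimately show ?thesis
    using sum_gap gap_zero by (simp add: t_def A_def B_def)
qed

end
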